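(* Consider LDPC codes with column weight $\gamma=3$ (every v-node of the Tanner graph has degree $3$) whose Tanner graph has girth $8$ and in which all cycles of length at most $12$ are chordless. For $b=0,1,2,3$, the minimum size $a$ of an $(a,b)$ elementary trapping set with $b<a$ in such codes is $a=10,9,8,5$, respectively.
   Context: An LDPC code is the null space over $\mathbb F_2$ of a binary parity-check matrix; its Tanner graph is the simple bipartite graph with variable-nodes (v-nodes, one per column) and check-nodes (c-nodes, one per row), adjacent iff the corresponding entry is $1$. The girth is the length of a shortest cycle. An $(a,b)$ trapping set is a set of $a\ge1$ v-nodes such that, in the subgraph induced by these v-nodes and all c-nodes adjacent to at least one of them, exactly $b$ c-nodes have odd degree. It is elementary if every c-node of this induced subgraph has degree $1$ or $2$. A cycle $C$ is chordless if no c-node outside $C$ is adjacent to two distinct v-nodes of $C$ and no edge not in $C$ joins a v-node of $C$ to a c-node of $C$. The "minimum size in such codes" for given $b$ is the minimum of $a$ over all $(a,b)$ elementary trapping sets with $b<a$ occurring in Tanner graphs of codes of the described class. *)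

theory Defs
  imports
    "HOL-Library.Z2"
    "HOL-Library.Extended_Nat"
    "Jordan_Normal_Form.Matrix_Kernel"
begin

text \<open>Simple graphs are represented as pairs of a node set and a set of two-element edges.\<close>

type_synonym 'a ugraph = "'a set \<times> 'a set set"

abbreviation gnodes :: "'a ugraph \<Rightarrow> 'a set" where
  "gnodes G \<equiv> fst G"

abbreviation gedges :: "'a ugraph \<Rightarrow> 'a set set" where
  "gedges G \<equiv> snd G"

definition adjacent :: "'a ugraph \<Rightarrow> 'a \<Rightarrow> 'a \<Rightarrow> bool" where
  "adjacent G x y \<longleftrightarrow> {x, y} \<in> gedges G"

definition node_degree :: "'a ugraph \<Rightarrow> 'a \<Rightarrow> nat" where
  "node_degree G x = card {e \<in> gedges G. x \<in> e}"

definition induced_subgraph :: "'a ugraph \<Rightarrow> 'a set \<Rightarrow> 'a ugraph" where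
  "induced_subgraph G W = (gnodes G \<inter> W, {e \<in> gedges G. e \<subseteq> W})"

text \<open>A cycle is given by the list of its nodes, each listed once (the first node is not
  repeated at the end), so that \<open>length p\<close> is also its number of edges.\<close>

definition cycle_edges :: "'a list \<Rightarrow> 'a set set" where
  "cycle_edges p = {{p ! i, p ! (Suc i mod length p)} | i. i < length p}"

definition is_cycle :: "'a ugraph \<Rightarrow> 'a list \<Rightarrow> bool" where
  "is_cycle G p \<longleftrightarrow>
     3 \<le> length p \<and> distinct p \<and> set p \<subseteq> gnodes G \<and> cycle_edges p \<subseteq> gedges G"

text \<open>The girth of an acyclic graph is \<open>\<infinity>\<close>.\<close>

definition girth :: "'a ugraph \<Rightarrow> enat" where
  "girth G = (INF p \<in> {p. is_cycle G p}. enat (length p))"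


text \<open>Column \<open>j\<close> of the parity-check matrix gives the v-node \<open>VNode j\<close>,
  row \<open>i\<close> the c-node \<open>CNode i\<close>.\<close>

datatype tanner_node = VNode nat | CNode nat

definition vnodes :: "bit mat \<Rightarrow> tanner_node set" where
  "vnodes H = VNode ` {..<dim_col H}"

definition cnodes :: "bit mat \<Rightarrow> tanner_node set" where
  "cnodes H = CNode ` {..<dim_row H}"

definition tanner_graph :: "bit mat \<Rightarrow> tanner_node ugraph" where
  "tanner_graph H =
     (vnodes H \<union> cnodes H,
      {{VNode j, CNode i} | i j. i < dim_row H \<and> j < dim_col H \<and> H $$ (i, j) = 1})"

definition parity_check_matrix :: "bit mat \<Rightarrow> bit vec set \<Rightarrow> bool" where
  "parity_check_matrix H C \<longleftrightarrow> C = mat_kernel H"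

definition column_weight :: "bit mat \<Rightarrow> nat \<Rightarrow> bool" where
  "column_weight H \<gamma> \<longleftrightarrow> (\<forall>v \<in> vnodes H. node_degree (tanner_graph H) v = \<gamma>)"

definition chordless :: "bit mat \<Rightarrow> tanner_node list \<Rightarrow> bool" where
  "chordless H p \<longleftrightarrow>
     \<not> (\<exists>c \<in> cnodes H - set p. \<exists>v \<in> set p \<inter> vnodes H. \<exists>w \<in> set p \<inter> vnodes H.
          v \<noteq> w \<and> adjacent (tanner_graph H) c v \<and> adjacent (tanner_graph H) c w) \<and>
     \<not> (\<exists>v \<in> set p \<inter> vnodes H. \<exists>c \<in> set p \<inter> cnodes H.
          {v, c} \<in> gedges (tanner_graph H) - cycle_edges p)"


definition neighbour_cnodes :: "bit mat \<Rightarrow> tanner_node set \<Rightarrow> tanner_node set" where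
  "neighbour_cnodes H S = {c \<in> cnodes H. \<exists>v \<in> S. adjacent (tanner_graph H) v c}"

definition trapping_subgraph :: "bit mat \<Rightarrow> tanner_node set \<Rightarrow> tanner_node ugraph" where
  "trapping_subgraph H S = induced_subgraph (tanner_graph H) (S \<union> neighbour_cnodes H S)"

definition trapping_set :: "bit mat \<Rightarrow> nat \<Rightarrow> nat \<Rightarrow> tanner_node set \<Rightarrow> bool" where
  "trapping_set H a b S \<longleftrightarrow>
     S \<subseteq> vnodes H \<and> card S = a \<and> 1 \<le> a \<and>
     card {c \<in> neighbour_cnodes H S. odd (node_degree (trapping_subgraph H S) c)} = b"

definition elementary :: "bit mat \<Rightarrow> tanner_node set \<Rightarrow> bool" where
  "elementary H S \<longleftrightarrow>
     (\<forall>c \<in> neighbour_cnodes H S. node_degree (trapping_subgraph H S) c \<in> {1, 2})"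

definition in_code_class :: "bit mat \<Rightarrow> bit vec set \<Rightarrow> bool" where
  "in_code_class H C \<longleftrightarrow>
     parity_check_matrix H C \<and> column_weight H 3 \<and> girth (tanner_graph H) = 8 \<and>
     (\<forall>p. is_cycle (tanner_graph H) p \<and> length p \<le> 12 \<longrightarrow> chordless H p)"

definition ets_sizes :: "nat \<Rightarrow> nat set" where
  "ets_sizes b =
     {a. b < a \<and> (\<exists>H C S. in_code_class H C \<and> trapping_set H a b S \<and> elementary H S)}"

definition is_minimum :: "nat set \<Rightarrow> nat \<Rightarrow> bool" where
  "is_minimum A m \<longleftrightarrow> m \<in> A \<and> (\<forall>a \<in> A. m \<le> a)"

end

theory Submission
  imports Defs
begin

text \<open>
  In an elementary trapping set with \<open>a\<close> v-nodes the c-nodes of degree 2 are the edges of a graph on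
  the v-nodes of maximum degree 3, in which the total deficiency (the sum of 3 minus the degree)
  is \<open>b\<close>. Girth 8 means that this graph is simple and triangle-free, and chordlessness of the
  12-cycles that no two 4-cycles share exactly one edge.

  Let \<open>b \<le> 2\<close>. Then some edge \<open>u v\<close> joins two nodes of degree 3, with further neighbours \<open>x1\<close>, \<open>x2\<close>
  and \<open>y1\<close>, \<open>y2\<close>. The edges between these two pairs contain no perfect matching, so one of the four
  nodes, say \<open>x2\<close>, must have its remaining neighbours among the other \<open>a - 6\<close> nodes. If
  \<open>a + b \<le> 8\<close>, this is so tight that the whole graph is determined up to a few cases, each of which
  contains two 4-cycles with a common edge. Since \<open>3 a = b + 2 e\<close>, also \<open>a + b = 9\<close> is impossible.
  For \<open>b = 3\<close> parity alone gives \<open>a \<ge> 5\<close>, attained by the complete bipartite graph \<open>K(2,3)\<close>; the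
  other bounds are attained by explicit graphs, in which each missing edge end becomes a row of
  weight 1.
\<close>

subsection \<open>Subcubic graphs of small deficiency\<close>

lemma eq_triple_if_subset:
  assumes "A \<subseteq> {a, b, c}" "card A = 3"
  shows "A = {a, b, c}"
proof (rule card_seteq)
  show "card {a, b, c} \<le> card A"
    using assms(2) by (simp add: card_insert_if)
qed (use assms in auto)

text \<open>\<open>N\<close> gives the neighbourhoods of a graph on \<open>S\<close>, and
  \<open>b\<close> is its total deficiency. \<open>domino\<close> forbids the 4-cycles
  \<open>p a d q\<close> and \<open>p c e q\<close> with the common edge \<open>p q\<close>. The
  bound is 9 and not 10, since equality is excluded by parity later.\<close>

lemma card_plus_deficiency_ge:
  fixes N :: "'a \<Rightarrow> 'a set"
  assumes fin: "finite S"
    and sub: "\<And>u. u \<in> S \<Longrightarrow> N u \<subseteq> S"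
    and sym: "\<And>u v. u \<in> S \<Longrightarrow> v \<in> N u \<Longrightarrow> u \<in> N v"
    and deg: "\<And>u. u \<in> S \<Longrightarrow> card (N u) \<le> 3"
    and tri: "\<And>u v. u \<in> S \<Longrightarrow> v \<in> N u \<Longrightarrow> N u \<inter> N v = {}"
    and domino: "\<And>p q a c d e. p \<in> S \<Longrightarrow> q \<in> N p \<Longrightarrow> {a, c} \<subseteq> N p - {q} \<Longrightarrow>
      {d, e} \<subseteq> N q - {p} \<Longrightarrow> a \<noteq> c \<Longrightarrow> d \<noteq> e \<Longrightarrow> d \<in> N a \<Longrightarrow> e \<in> N c \<Longrightarrow> False"
    and b: "(\<Sum>u\<in>S. 3 - card (N u)) = b" "b \<le> 2" "b < card S"
  shows "9 \<le> card S + b"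
proof (rule ccontr)
  assume "\<not> 9 \<le> card S + b"
  then have small: "card S + b \<le> 8" by simp
  have deficiency_le: "(\<Sum>u\<in>T. 3 - card (N u)) \<le> b" if "T \<subseteq> S" for T
    unfolding b(1)[symmetric] using that fin by (intro sum_mono2) auto
  have finN: "finite (N u)" if "u \<in> S" for u
    using sub[OF that] fin by (rule finite_subset)
  \<comment> \<open>Every node of degree below 3 adds at least 1 to the deficiency, so more than
    \<open>b\<close> nodes cannot all be of this kind. This applies to \<open>S\<close> and, as
    \<open>b\<close> is at most 2, to the three neighbours of \<open>u\<close>.\<close>
  have full_in: "\<exists>v\<in>T. card (N v) = 3" if "T \<subseteq> S" "b < card T" for T
  proof (rule ccontr)
    assume "\<not> (\<exists>v\<in>T. card (N v) = 3)"
    then have "1 \<le> 3 - card (N v)" if "v \<in> T" for v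
      using deg[of v] \<open>T \<subseteq> S\<close> that by (metis One_nat_def Suc_leI in_mono le_neq_implies_less zero_less_diff)
    then have "(\<Sum>v\<in>T. 1) \<le> (\<Sum>v\<in>T. 3 - card (N v))" by (rule sum_mono)
    then show False using deficiency_le[of T] that by simp
  qed
  obtain u where u: "u \<in> S" "card (N u) = 3" using full_in[of S] b(3) by auto
  obtain v where v: "v \<in> N u" "card (N v) = 3"
    using full_in[of "N u"] sub u b(2) by auto
  have vS: "v \<in> S" using sub u v by auto
  have other: "\<exists>x1 x2. N p = {q, x1, x2} \<and> distinct [q, x1, x2]"
    if "card (N p) = 3" "q \<in> N p" for p q
  proof -
    have "card (N p - {q}) = 2" using that by simp
    then obtain x1 x2 where "N p - {q} = {x1, x2}" "x1 \<noteq> x2" by (auto simp: card_2_iff)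
    then have "N p = {q, x1, x2} \<and> distinct [q, x1, x2]"
      using insert_Diff[OF that(2)] by force
    then show ?thesis by blast
  qed
  \<comment> \<open>The four cases of the final disjunction are relabelled instances of this one:
    exchange \<open>u\<close> with \<open>v\<close>, or the two names within a pair.\<close>
  have key: False
    if uS: "u \<in> S" and vS: "v \<in> S"
      and Nu: "N u = {v, x1, x2}" and Nv: "N v = {u, y1, y2}"
      and dist: "distinct [v, x1, x2]" "distinct [u, y1, y2]"
      and no: "y1 \<notin> N x2" "y2 \<notin> N x2"
    for u v x1 x2 y1 y2
  proof -
    define W where "W = S - {u, v, x1, x2, y1, y2}"
    have S: "x1 \<in> S" "x2 \<in> S" "y1 \<in> S" "y2 \<in> S"
      using sub[OF uS] sub[OF vS] Nu Nv by auto
    have irr: "p \<notin> N p" if "p \<in> S" for p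
      using tri[OF that, of p] by auto
    have "N u \<inter> N v = {}" using tri[OF uS] Nu by auto
    then have six: "distinct [u, v, x1, x2, y1, y2]"
      using dist Nu Nv irr uS vS by auto
    then have "card {u, v, x1, x2, y1, y2} = 6" by simp
    then have cardW: "card W + 6 = card S" and finW: "finite W"
      unfolding W_def using card_Diff_subset[of "{u, v, x1, x2, y1, y2}" S]
        card_mono[OF fin, of "{u, v, x1, x2, y1, y2}"] fin S uS vS by auto
    have nonadj: "x1 \<notin> N x2" "x2 \<notin> N x1" "v \<notin> N x1" "v \<notin> N x2"
        "y1 \<notin> N y2" "y2 \<notin> N y1" "u \<notin> N y1" "u \<notin> N y2"
      using tri[OF uS, of x1] tri[OF uS, of x2] tri[OF vS, of y1] tri[OF vS, of y2] Nu Nv by auto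
    \<comment> \<open>All further neighbours of \<open>x2\<close> lie in \<open>W\<close>, while \<open>card W + b \<le> 2\<close>: hence \<open>x2\<close> is
      adjacent to all of \<open>W\<close> and carries the whole deficiency.\<close>
    have "N x2 \<subseteq> insert u W"
      using sub[OF S(2)] no nonadj irr[OF S(2)] by (auto simp: W_def)
    then have Nx2: "card (N x2) \<le> Suc (card W)" and 
      eqx2: "card (N x2) = Suc (card W) \<Longrightarrow> N x2 = insert u W"
      using finW card_mono[of "insert u W" "N x2"] card_subset_eq[of "insert u W" "N x2"]
      by (auto simp: W_def)
    have total: "b = (3 - card (N x2)) + (\<Sum>z\<in>S - {x2}. 3 - card (N z))"
      using b(1) sum.remove[OF fin S(2), of "\<lambda>z. 3 - card (N z)"] by simp
    with Nx2 cardW small have cW: "card W + b = 2" by linarith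
    with Nx2 cardW total have "card (N x2) = Suc (card W)"
      and "(\<Sum>z\<in>S - {x2}. 3 - card (N z)) = 0" by linarith+
    with eqx2 fin have Nx2: "N x2 = insert u W" and
      ge: "\<And>z. z \<in> S \<Longrightarrow> z \<noteq> x2 \<Longrightarrow> card (N z) = 3"
      using deg by (auto intro!: le_antisym)
    have rest: "N y1 \<subseteq> {v, x1} \<union> W" "N y2 \<subseteq> {v, x1} \<union> W"
      using sub[OF S(3)] sub[OF S(4)] no nonadj irr S sym
      by (auto simp: W_def)
    have in_v: "v \<in> N y1" "v \<in> N y2" "u \<in> N x1" using sym uS vS Nu Nv by auto
    \<comment> \<open>The 4-cycles \<open>v u x1 y\<close> and \<open>v y w y'\<close> share the edge \<open>v y\<close>.\<close>
    have square: False
      if "x1 \<in> N y" "w \<in> N y" "w \<in> N y'" "{y, y'} = {y1, y2}" "w \<in> W" for y y' w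
    proof (rule domino[of v y u y' x1 w])
      show "y \<in> N v" using that Nv by auto
      show "{u, y'} \<subseteq> N v - {y}" "u \<noteq> y'" using that Nv six by (auto simp: doubleton_eq_iff)
      show "{x1, w} \<subseteq> N y - {v}" "x1 \<noteq> w" using that six by (auto simp: W_def)
      show "x1 \<in> N u" using Nu by auto
    qed (use vS that in auto)
    have "card W \<le> 2" using cW by simp
    then consider "W = {}" | w where "W = {w}" | w1 w2 where "W = {w1, w2}" "w1 \<noteq> w2"
      using finW by (metis card_0_eq card_1_singletonE card_2_iff le_Suc_eq le_zero_eq numeral_2_eq_2 One_nat_def)
    then show False
    proof cases
      case 1
      then have "card (N y1) \<le> card {v, x1}" using rest by (intro card_mono) auto
      then show False using ge[of y1] S six by auto
    next
      case 2
      then have "N y1 = {v, x1, w}" "N y2 = {v, x1, w}"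
        using ge S six rest by (auto intro!: eq_triple_if_subset)
      with 2 square[of y1 w y2] show False by simp
    next
      case 3
      \<comment> \<open>Now \<open>b = 0\<close> and all eight nodes have degree 3. Besides
        \<open>x2\<close>, the nodes \<open>w1\<close> and \<open>w2\<close> can only be adjacent to
        \<open>x1\<close>, \<open>y1\<close>, \<open>y2\<close>.\<close>
      have wS: "w1 \<in> S" "w2 \<in> S" and wne: "{w1,w2} \<inter> {u,v,x1,x2,y1,y2} = {}" using 3 by (auto simp: W_def)
      have x2w: "x2 \<in> N w1" "x2 \<in> N w2" using Nx2 3 sym S by auto
      have "N x2 \<inter> N w1 = {}" "N x2 \<inter> N w2 = {}" using tri S Nx2 3 by auto
      moreover have "v \<notin> N w1" "v \<notin> N w2"
        using sym[OF wS(1), of v] sym[OF wS(2), of v] Nv wne by auto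
      moreover have subS: "S \<subseteq> {u, v, x1, x2, y1, y2, w1, w2}" using 3(1) unfolding W_def by blast
      ultimately have Nw: "N w1 \<subseteq> {x2, x1, y1, y2}" "N w2 \<subseteq> {x2, x1, y1, y2}"
        using sub[OF wS(1)] sub[OF wS(2)] Nx2 3(1) by blast+
      have deg3: "card (N y1) = 3" "card (N y2) = 3" "card (N w1) = 3" "card (N w2) = 3"
         "card (N x1) = 3"
        using ge S wS six wne by auto
      have eq: "N z = {a, b, c}"
        if "{a, b, c} \<subseteq> N z" "distinct [a, b, c]" "z \<in> S" "card (N z) = 3" for z a b c
        using that finN by (intro card_subset_eq[symmetric]) auto
      have pair: "z1 \<in> A \<or> z2 \<in> A" if "A \<subseteq> {v, x1, z1, z2}" "card A = 3" for A z1 z2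
      proof (rule ccontr)
        assume "\<not> ?thesis"
        then have "A \<subseteq> {v, x1}" using that by auto
        then have "card A \<le> card {v, x1}" by (intro card_mono) auto
        then show False using that(2) six by simp
      qed
      have Ny: "N y1 \<subseteq> {v, x1, w1, w2}" "N y2 \<subseteq> {v, x1, w1, w2}" using rest 3 by auto
      \<comment> \<open>\<open>x1\<close> is adjacent to both of \<open>y1\<close>,
        \<open>y2\<close> or to neither: a node \<open>y'\<close> not adjacent to \<open>x1\<close>
        needs \<open>v\<close>, \<open>w1\<close>, \<open>w2\<close> as neighbours, and
        \<open>y\<close> then shares \<open>w1\<close> or \<open>w2\<close> with it.\<close>
      have one: False if "x1 \<in> N y" "x1 \<notin> N y'" "{y, y'} = {y1, y2}" for y y'
      proof -
        have "N y' \<subseteq> {v, w1, w2}" "card (N y') = 3" "N y \<subseteq> {v, x1, w1, w2}" "card (N y) = 3"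
          using that Ny deg3 by (auto simp: doubleton_eq_iff)
        then have "N y' = {v, w1, w2}" "w1 \<in> N y \<or> w2 \<in> N y" 
          using eq_triple_if_subset[of "N y'" v w1 w2] pair[of "N y" w1 w2] by simp_all
        then show False using square[of y _ y'] that 3 by blast
      qed
      show False
      proof (cases "x1 \<in> N y1")
        case True
        \<comment> \<open>The neighbours of \<open>x1\<close> are now used up, so \<open>w1\<close>
          must be adjacent to both \<open>y1\<close> and \<open>y2\<close>, and
          \<open>square\<close> applies.\<close>
        then have y2: "x1 \<in> N y2" using one[of y1 y2] by auto
        have x1: "N x1 = {u, y1, y2}"
          using six sym S True y2 in_v deg3 by (intro eq) auto
        have "x1 \<notin> N w1" "x1 \<notin> N w2" using sym[OF wS(1), of x1] sym[OF wS(2), of x1] x1 wne by auto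
        then have "N w1 \<subseteq> {x2, y1, y2}" using Nw by auto
        then have "N w1 = {x2, y1, y2}" using deg3 by (intro eq_triple_if_subset)
        then have "w1 \<in> N y1" "w1 \<in> N y2" using sym[OF wS(1)] by auto
        then show False using square[of y1 w1 y2] True 3 by auto
      next
        case False
        \<comment> \<open>Both \<open>w1\<close> and \<open>w2\<close> have the neighbours
          \<open>x2\<close>, \<open>y1\<close>, \<open>y2\<close>, which leaves \<open>x1\<close>
          with \<open>u\<close> alone.\<close>
        then have y2: "x1 \<notin> N y2" using one[of y2 y1] by auto
        have "N y1 = {v, w1, w2}" "N y2 = {v, w1, w2}"
          using Ny False y2 deg3 by (auto intro!: eq_triple_if_subset)
        then have "{x2, y1, y2} \<subseteq> N w1" "{x2, y1, y2} \<subseteq> N w2" using sym S x2w by auto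
        then have "N w1 = {x2, y1, y2}" "N w2 = {x2, y1, y2}"
          using deg3 six wS by (intro eq; simp)+
        then have "w1 \<notin> N x1" "w2 \<notin> N x1" "y1 \<notin> N x1" "y2 \<notin> N x1"
          using sym[OF S(1), of w1] sym[OF S(1), of w2] sym[OF S(1), of y1] sym[OF S(1), of y2]
            False y2 six by auto
        then have "N x1 \<subseteq> {u}"
          using sub[OF S(1)] nonadj irr[OF S(1)] subS by blast
        then have "card (N x1) \<le> card {u}" by (intro card_mono) auto
        then show False using deg3 by simp
      qed
    qed
  qed
  obtain x1 x2 where x: "N u = {v, x1, x2}" "distinct [v, x1, x2]" using other u v by blast
  have "u \<in> N v" using sym u v by auto
  then obtain y1 y2 where y: "N v = {u, y1, y2}" "distinct [u, y1, y2]" using other v by blast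
  have yS: "x1 \<in> S" "x2 \<in> S" "y1 \<in> S" "y2 \<in> S" using sub u vS x y by auto
  \<comment> \<open>A perfect matching between the two pairs closes two 4-cycles that share the edge
    \<open>u v\<close>.\<close>
  have m1: False if "y1 \<in> N x1" "y2 \<in> N x2"
    using that domino[of u v x1 x2 y1 y2] u v x y by auto
  have m2: False if "y2 \<in> N x1" "y1 \<in> N x2"
    using that domino[of u v x1 x2 y2 y1] u v x y by auto
  \<comment> \<open>A bipartite graph on 2 + 2 nodes without a perfect matching has an isolated node.\<close>
  have "(y1 \<notin> N x2 \<and> y2 \<notin> N x2) \<or> (y1 \<notin> N x1 \<and> y2 \<notin> N x1) \<or>
    (x1 \<notin> N y2 \<and> x2 \<notin> N y2) \<or> (x1 \<notin> N y1 \<and> x2 \<notin> N y1)"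
    using m1 m2 sym yS by blast
  then show False
    using key[of u v x1 x2 y1 y2] key[of u v x2 x1 y1 y2] key[of v u y1 y2 x1 x2]
      key[of v u y2 y1 x1 x2] u(1) vS x y by (auto simp: insert_commute)
qed

subsection \<open>Trapping sets as subcubic graphs\<close>

definition incident :: "bit mat \<Rightarrow> nat \<Rightarrow> nat \<Rightarrow> bool" where
  "incident H i j \<longleftrightarrow> i < dim_row H \<and> j < dim_col H \<and> H $$ (i, j) = 1"

text \<open>Restricted to an elementary trapping set, this is the graph known in coding theory as
  its normal graph: c-nodes of degree 2 become edges, those of degree 1 disappear.\<close>

definition col_adj :: "bit mat \<Rightarrow> nat \<Rightarrow> nat \<Rightarrow> bool" where
  "col_adj H j k \<longleftrightarrow> j \<noteq> k \<and> (\<exists>i. incident H i j \<and> incident H i k)"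

lemma col_adj_sym: "col_adj H j k \<Longrightarrow> col_adj H k j"
  by (auto simp: col_adj_def)

lemma incident_bounds: "incident H i j \<Longrightarrow> i < dim_row H \<and> j < dim_col H"
  by (simp add: incident_def)

lemma tanner_edges: "gedges (tanner_graph H) = {{VNode j, CNode i} | i j. incident H i j}"
  by (auto simp: tanner_graph_def incident_def)

lemma tanner_edge_simps [simp]:
  "{VNode j, CNode i} \<in> gedges (tanner_graph H) \<longleftrightarrow> incident H i j"
  "{CNode i, VNode j} \<in> gedges (tanner_graph H) \<longleftrightarrow> incident H i j"
  "{VNode j, VNode k} \<notin> gedges (tanner_graph H)"
  "{CNode i, CNode l} \<notin> gedges (tanner_graph H)"
  by (auto simp: tanner_edges doubleton_eq_iff)

lemma finite_incident_rows [simp]: "finite {i. incident H i j \<and> P i}"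
  by (rule finite_subset[of _ "{..<dim_row H}"]) (auto simp: incident_def)

lemma node_degree_VNode: "node_degree (tanner_graph H) (VNode j) = card {i. incident H i j}"
proof -
  have "{e \<in> gedges (tanner_graph H). VNode j \<in> e} =
      (\<lambda>i. {VNode j, CNode i}) ` {i. incident H i j}"
    by (auto simp: tanner_edges)
  then show ?thesis
    unfolding node_degree_def by (simp add: card_image inj_on_def doubleton_eq_iff)
qed

lemma column_weight_iff:
  "column_weight H g \<longleftrightarrow> (\<forall>j < dim_col H. card {i. incident H i j} = g)"
  by (auto simp: column_weight_def vnodes_def node_degree_VNode)

lemma neighbour_cnodes_VNode:
  "neighbour_cnodes H (VNode ` J) = CNode ` {i. \<exists>j\<in>J. incident H i j}"
proof -
  have "adjacent (tanner_graph H) (VNode j) (CNode i) \<longleftrightarrow> incident H i j" for i j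
    by (simp add: adjacent_def)
  then show ?thesis
    unfolding neighbour_cnodes_def cnodes_def using incident_bounds by blast
qed

lemma node_degree_trapping_subgraph:
  assumes "\<exists>j\<in>J. incident H i j"
  shows "node_degree (trapping_subgraph H (VNode ` J)) (CNode i) = card {j \<in> J. incident H i j}"
proof -
  have "{e \<in> gedges (trapping_subgraph H (VNode ` J)). CNode i \<in> e} =
      (\<lambda>j. {VNode j, CNode i}) ` {j \<in> J. incident H i j}"
    by (auto simp: trapping_subgraph_def induced_subgraph_def neighbour_cnodes_VNode tanner_edges)
  then show ?thesis
    unfolding node_degree_def by (simp add: card_image inj_on_def doubleton_eq_iff)
qed

lemma trapping_set_VNode_iff:
  "trapping_set H a b (VNode ` J) \<longleftrightarrow>
     J \<subseteq> {..<dim_col H} \<and> card J = a \<and> 1 \<le> a \<and> card {i. odd (card {j \<in> J. incident H i j})} = b"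
proof -
  have "(\<exists>j\<in>J. incident H i j) \<and> odd (node_degree (trapping_subgraph H (VNode ` J)) (CNode i))
      \<longleftrightarrow> odd (card {j \<in> J. incident H i j})" for i
  proof (cases "\<exists>j\<in>J. incident H i j")
    case False
    then have "{j \<in> J. incident H i j} = {}" by blast
    then show ?thesis using False by (metis card.empty even_zero)
  qed (simp add: node_degree_trapping_subgraph)
  moreover have "{c \<in> CNode ` A. P c} = CNode ` {i. i \<in> A \<and> P (CNode i)}" for A P by auto
  ultimately have "{c \<in> neighbour_cnodes H (VNode ` J).
      odd (node_degree (trapping_subgraph H (VNode ` J)) c)} =
      CNode ` {i. odd (card {j \<in> J. incident H i j})}"
    unfolding neighbour_cnodes_VNode by simp
  then show ?thesis
    by (auto simp: trapping_set_def vnodes_def card_image inj_on_def)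
qed

lemma trapping_setE:
  assumes "trapping_set H a b S"
  obtains J where "S = VNode ` J"
  using assms by (auto simp: trapping_set_def vnodes_def subset_image_iff)

lemma elementary_VNode_iff:
  assumes "J \<subseteq> {..<dim_col H}"
  shows "elementary H (VNode ` J) \<longleftrightarrow> (\<forall>i. card {j \<in> J. incident H i j} \<le> 2)"
proof -
  have "finite J" using assms finite_subset by blast
  then have *: "card {j \<in> J. incident H i j} = 0 \<longleftrightarrow> \<not> (\<exists>j\<in>J. incident H i j)" for i
    by auto
  have "n \<le> 2 \<longleftrightarrow> n = 0 \<or> n = 1 \<or> n = 2" for n :: nat by auto
  with * show ?thesis
    unfolding elementary_def neighbour_cnodes_VNode
    by (auto simp: node_degree_trapping_subgraph)
qed

text \<open>Count the ones in the columns \<open>J\<close> twice: by columns there are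
  \<open>3 * a\<close>, by rows their number has the parity of the number \<open>b\<close> of odd
  rows.\<close>

lemma trapping_set_parity:
  assumes "column_weight H 3" "trapping_set H a b S"
  shows "even (a + b)"
proof -
  obtain J where S: "S = VNode ` J" using assms(2) by (rule trapping_setE)
  then have J: "J \<subseteq> {..<dim_col H}" "card J = a"
    and b: "card {i. odd (card {j \<in> J. incident H i j})} = b"
    using assms(2) by (auto simp: trapping_set_VNode_iff)
  have finJ: "finite J" using J finite_subset by blast
  have rows: "{i \<in> {..<dim_row H}. incident H i j} = {i. incident H i j}" for j
    using incident_bounds by auto
  have "(\<Sum>i<dim_row H. card {j \<in> J. incident H i j}) = 3 * card J"
    using assms(1) J finJ
    by (intro sum_multicount) (auto simp: column_weight_iff rows[unfolded lessThan_iff])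
  moreover have "{i \<in> {..<dim_row H}. odd (card {j \<in> J. incident H i j})} =
      {i. odd (card {j \<in> J. incident H i j})}"
    using incident_bounds by (auto simp: odd_card_imp_not_empty) (metis (no_types, lifting) Collect_empty_eq card.empty even_zero)
  ultimately show ?thesis
    using even_sum_iff[of "{..<dim_row H}" "\<lambda>i. card {j \<in> J. incident H i j}"] b J by simp
qed

section \<open>Short cycles of the Tanner graph\<close>

lemma is_cycle_tanner_iff:
  "is_cycle (tanner_graph H) p \<longleftrightarrow> 3 \<le> length p \<and> distinct p \<and>
     (\<forall>i < length p. {p ! i, p ! (Suc i mod length p)} \<in> gedges (tanner_graph H))"
proof -
  have "x \<in> gnodes (tanner_graph H)" if "{x, y} \<in> gedges (tanner_graph H)" for x y
    using that by (auto simp: tanner_edges tanner_graph_def vnodes_def cnodes_def doubleton_eq_iff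
      dest: incident_bounds)
  then show ?thesis
    unfolding is_cycle_def cycle_edges_def by (auto simp: in_set_conv_nth) blast
qed

text \<open>Appending the head replaces the indices modulo the length, so that explicit cycles can
  be checked by simplification.\<close>

lemma is_cycle_tanner_successively:
  "is_cycle (tanner_graph H) p \<longleftrightarrow> 3 \<le> length p \<and> distinct p \<and>
     successively (\<lambda>x y. {x, y} \<in> gedges (tanner_graph H)) (p @ [hd p])"
proof (cases "p = []")
  case False
  have "(p @ [hd p]) ! i = p ! i" "(p @ [hd p]) ! Suc i = p ! (Suc i mod length p)"
    if "i < length p" for i
    using that False by (auto simp: nth_append hd_conv_nth mod_Suc)
  then show ?thesis
    by (auto simp: is_cycle_tanner_iff successively_conv_nth)
qed (simp add: is_cycle_def)

lemma in_code_class_cycle_length: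
  assumes "in_code_class H C" "is_cycle (tanner_graph H) p"
  shows "8 \<le> length p"
proof -
  have "girth (tanner_graph H) \<le> enat (length p)"
    unfolding girth_def using assms(2) by (intro INF_lower) simp
  then show ?thesis using assms(1) by (simp add: in_code_class_def numeral_eq_enat)
qed

lemma in_code_class_rows_unique:
  assumes "in_code_class H C" "j \<noteq> k"
    and "incident H i j" "incident H i k" "incident H l j" "incident H l k"
  shows "i = l"
proof (rule ccontr)
  assume "i \<noteq> l"
  then have "is_cycle (tanner_graph H) [VNode j, CNode i, VNode k, CNode l]"
    using assms by (simp add: is_cycle_tanner_successively)
  from in_code_class_cycle_length[OF assms(1) this] show False by simp
qed

lemma in_code_class_no_triangle:
  assumes "in_code_class H C" "distinct [a, b, c]" "distinct [i, j, k]"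
    and "incident H i a" "incident H i b" "incident H j b" "incident H j c"
      "incident H k c" "incident H k a"
  shows False
proof -
  have "is_cycle (tanner_graph H) [VNode a, CNode i, VNode b, CNode j, VNode c, CNode k]"
    using assms by (simp add: is_cycle_tanner_successively)
  from in_code_class_cycle_length[OF assms(1) this] show False by simp
qed

text \<open>In the column graph, the row \<open>r\<close> is a long diagonal of the 6-cycle
  \<open>a b c d e f\<close> and cuts it into two 4-cycles with the common edge
  \<open>a d\<close>.\<close>

lemma in_code_class_no_chord:
  assumes "in_code_class H C" "distinct [a, b, c, d, e, f]" "distinct [i, j, k, l, m, n]"
    and "incident H i a" "incident H i b" "incident H j b" "incident H j c"
      "incident H k c" "incident H k d" "incident H l d" "incident H l e"
      "incident H m e" "incident H m f" "incident H n f" "incident H n a"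
    and "r \<notin> {i, j, k, l, m, n}" "incident H r a" "incident H r d"
  shows False
proof -
  let ?p = "[VNode a, CNode i, VNode b, CNode j, VNode c, CNode k,
    VNode d, CNode l, VNode e, CNode m, VNode f, CNode n]"
  have "is_cycle (tanner_graph H) ?p"
    using assms by (simp add: is_cycle_tanner_successively)
  then have "chordless H ?p" using assms(1) by (simp add: in_code_class_def)
  moreover have "CNode r \<in> cnodes H - set ?p" "VNode a \<in> set ?p \<inter> vnodes H"
      "VNode d \<in> set ?p \<inter> vnodes H" "VNode a \<noteq> VNode d"
    using assms incident_bounds by (auto simp: cnodes_def vnodes_def)
  moreover have "adjacent (tanner_graph H) (CNode r) (VNode a)"
      "adjacent (tanner_graph H) (CNode r) (VNode d)"
    using assms by (auto simp: adjacent_def)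
  ultimately show False unfolding chordless_def by blast
qed

text \<open>An instance of \<open>card_plus_deficiency_ge\<close>: rows that meet \<open>J\<close>
  twice are the edges of the graph \<open>N\<close>, rows that meet it once make up the
  deficiency.\<close>

lemma ets_size_ge:
  assumes code: "in_code_class H C" and ts: "trapping_set H a b S" and el: "elementary H S"
    and b: "b \<le> 2" "b < a"
  shows "9 \<le> a + b"
proof -
  obtain J where S: "S = VNode ` J" using ts by (rule trapping_setE)
  then have J: "J \<subseteq> {..<dim_col H}" "card J = a"
    and odd: "card {i. odd (card {j \<in> J. incident H i j})} = b"
    using ts by (auto simp: trapping_set_VNode_iff)
  have finJ: "finite J" using J finite_subset by blast
  define R where "R i = {j \<in> J. incident H i j}" for i
  have finR: "finite (R i)" for i using finJ by (simp add: R_def)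
  have R2: "card (R i) \<le> 2" for i
    using el J by (auto simp: S elementary_VNode_iff R_def)
  have two: "x = y \<or> x = z \<or> y = z" if "x \<in> R i" "y \<in> R i" "z \<in> R i" for i x y z
  proof (rule ccontr)
    assume "\<not> ?thesis"
    then have "card {x, y, z} = 3" by simp
    then show False using card_mono[OF finR, of "{x, y, z}" i] R2[of i] that by simp
  qed
  have w3: "card {i. incident H i j} = 3" if "j \<in> J" for j
    using code J that by (auto simp: in_code_class_def column_weight_iff)
  define N where "N j = {k \<in> J. col_adj H j k}" for j
  define L where "L j = {i. incident H i j \<and> card (R i) = 1}" for j
  have defic: "card (L j) + card (N j) = 3" if j: "j \<in> J" for j
  proof -
    \<comment> \<open>\<open>f\<close> sends a neighbour of \<open>j\<close> to a row shared with
      \<open>j\<close>. It is injective because a row meets \<open>J\<close> at most twice, and onto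
      \<open>D\<close> because two columns share at most one row. The three rows of \<open>j\<close>
      split into \<open>D\<close> and \<open>L j\<close>.\<close>
    define D where "D = {i. incident H i j \<and> card (R i) = 2}"
    define f where "f k = (SOME i. incident H i j \<and> incident H i k)" for k
    have f: "incident H (f k) j \<and> incident H (f k) k" if "k \<in> N j" for k
      unfolding f_def by (rule someI_ex) (use that in \<open>auto simp: N_def col_adj_def\<close>)
    have "inj_on f (N j)"
    proof (rule inj_onI)
      fix k l assume kl: "k \<in> N j" "l \<in> N j" "f k = f l"
      then have "j \<in> R (f k)" "k \<in> R (f k)" "l \<in> R (f k)" "j \<noteq> k" "j \<noteq> l"
        using f[of k] f[of l] j by (auto simp: R_def N_def col_adj_def)
      then show "k = l" using two by blast
    qed
    moreover have "f ` N j = D"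
    proof (intro equalityI subsetI)
      fix i assume "i \<in> f ` N j"
      then obtain k where k: "k \<in> N j" "i = f k" by blast
      then have "{j, k} \<subseteq> R i" "j \<noteq> k" using f[of k] j by (auto simp: R_def N_def col_adj_def)
      then have "card (R i) = 2" using card_mono[OF finR, of "{j, k}" i] R2[of i] by simp
      then show "i \<in> D" using f k by (simp add: D_def)
    next
      fix i assume i: "i \<in> D"
      then have "j \<in> R i" "card (R i) = 2" using j by (auto simp: D_def R_def)
      then obtain k where k: "k \<in> R i" "k \<noteq> j" by (auto simp: card_2_iff)
      then have kN: "k \<in> N j" using i by (auto simp: R_def D_def N_def col_adj_def)
      have "f k = i"
        using in_code_class_rows_unique[OF code k(2)] f[OF kN] i k by (auto simp: R_def D_def)
      then show "i \<in> f ` N j" using kN by blast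
    qed
    ultimately have "card (N j) = card D" using card_image by fastforce
    moreover have "{i. incident H i j} = L j \<union> D"
    proof -
      have "card (R i) = 1 \<or> card (R i) = 2" if "incident H i j" for i
      proof -
        have "card (R i) \<noteq> 0" using that j finR by (auto simp: R_def)
        then show ?thesis using R2[of i] by linarith
      qed
      then show ?thesis by (auto simp: L_def D_def)
    qed
    moreover have "L j \<inter> D = {}" by (auto simp: L_def D_def)
    ultimately show ?thesis
      using w3[OF j] card_Un_disjoint[of "L j" D] by (simp add: L_def D_def)
  qed
  \<comment> \<open>Each row that meets \<open>J\<close> exactly once lies in a single
    \<open>L j\<close>, and these are exactly the rows of odd degree. Hence the deficiencies add up
    to \<open>b\<close>.\<close>
  have "card (\<Union>j\<in>J. L j) = (\<Sum>j\<in>J. card (L j))"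
  proof (rule card_UN_disjoint[OF finJ])
    show "\<forall>j\<in>J. \<forall>k\<in>J. j \<noteq> k \<longrightarrow> L j \<inter> L k = {}"
    proof (intro ballI impI equals0I)
      fix j k i assume *: "j \<in> J" "k \<in> J" "j \<noteq> k" "i \<in> L j \<inter> L k"
      then have "{j, k} \<subseteq> R i" "card (R i) = 1" by (auto simp: L_def R_def)
      then show False using card_mono[OF finR, of "{j, k}" i] * by simp
    qed
  qed (simp add: L_def)
  moreover have "(\<Union>j\<in>J. L j) = {i. odd (card (R i))}"
  proof (intro equalityI subsetI)
    fix i assume "i \<in> {i. odd (card (R i))}"
    then have "card (R i) = 1" using R2[of i] by (cases "card (R i) = 2"; cases "card (R i) = 0") (auto)
    then show "i \<in> (\<Union>j\<in>J. L j)" by (auto simp: L_def R_def card_1_singleton_iff)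
  qed (auto simp: L_def)
  moreover have "card (L j) = 3 - card (N j)" if "j \<in> J" for j
    using defic[OF that] by simp
  ultimately have sum: "(\<Sum>j\<in>J. 3 - card (N j)) = b"
    using odd by (simp add: R_def)
  \<comment> \<open>The trace \<open>R i\<close> is recorded because it determines the edge: rows of
    different edges have different traces and are therefore distinct.\<close>
  have common: "\<exists>i. incident H i x \<and> incident H i y \<and> R i = {x, y} \<and> x \<noteq> y" if "x \<in> J" "y \<in> N x" for x y
  proof -
    obtain i where i: "incident H i x" "incident H i y" "x \<noteq> y" "y \<in> J"
      using \<open>y \<in> N x\<close> by (auto simp: N_def col_adj_def)
    then have "x \<in> R i" "y \<in> R i" using that by (auto simp: R_def)
    then show ?thesis using two[of _ i] i by blast
  qed
  have tri: False if xyz: "x \<in> J" "y \<in> N x" "z \<in> N x" "z \<in> N y" for x y z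
  proof -
    have yJ: "y \<in> J" using xyz by (simp add: N_def)
    obtain i where i: "incident H i x" "incident H i y" "R i = {x, y}" "x \<noteq> y"
      using common[OF xyz(1,2)] by blast
    obtain j where j: "incident H j y" "incident H j z" "R j = {y, z}" "y \<noteq> z"
      using common[OF yJ xyz(4)] by blast
    obtain k where k: "incident H k x" "incident H k z" "R k = {x, z}" "x \<noteq> z"
      using common[OF xyz(1,3)] by blast
    have "distinct [i, j, k]" using i j k by (auto simp: doubleton_eq_iff)
    then show False
      using in_code_class_no_triangle[OF code, of x y z i j k] i j k by simp
  qed
  have "9 \<le> card J + b"
  proof (rule card_plus_deficiency_ge[OF finJ, of N])
    fix u v assume uv: "u \<in> J" "v \<in> N u"
    show "u \<in> N v" using uv col_adj_sym by (auto simp: N_def)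
    show "N u \<inter> N v = {}" using tri[OF uv] by blast
  next
    fix p q a c d e
    assume *: "p \<in> J" "q \<in> N p" "{a, c} \<subseteq> N p - {q}" "{d, e} \<subseteq> N q - {p}"
      "a \<noteq> c" "d \<noteq> e" "d \<in> N a" "e \<in> N c"
    then have inJ: "q \<in> J" "a \<in> J" "c \<in> J" "d \<in> J" "e \<in> J" by (auto simp: N_def)
    obtain r where r: "incident H r p" "incident H r q" "R r = {p, q}" "p \<noteq> q"
      using common * by blast
    obtain i where i: "incident H i p" "incident H i a" "R i = {p, a}" "p \<noteq> a"
      using common[of p a] * by blast
    obtain j where j: "incident H j a" "incident H j d" "R j = {a, d}" "a \<noteq> d"
      using common[of a d] * inJ by blast
    obtain k where k: "incident H k q" "incident H k d" "R k = {q, d}" "q \<noteq> d"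
      using common[of q d] * inJ by blast
    obtain l where l: "incident H l q" "incident H l e" "R l = {q, e}" "q \<noteq> e"
      using common[of q e] * inJ by blast
    obtain m where m: "incident H m c" "incident H m e" "R m = {c, e}" "c \<noteq> e"
      using common[of c e] * inJ by blast
    obtain n where n: "incident H n p" "incident H n c" "R n = {p, c}" "p \<noteq> c"
      using common[of p c] * inJ by blast
    have dist: "distinct [p, a, d, q, e, c]"
      using * i j k l m n r tri[of p q a] tri[of p q c] by auto
    have "distinct (map R [i, j, k, l, m, n, r])"
      using dist by (auto simp: i(3) j(3) k(3) l(3) m(3) n(3) r(3) doubleton_eq_iff)
    then have "distinct [i, j, k, l, m, n, r]" by (simp only: distinct_map)
    then have "distinct [i, j, k, l, m, n]" "r \<notin> {i, j, k, l, m, n}" by auto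
    from in_code_class_no_chord[OF code dist this(1) i(1,2) j(1,2) k(2,1) l(1,2) m(2,1) n(2,1)
        this(2) r(1,2)]
    show False .
  next
    fix u assume "u \<in> J"
    then show "card (N u) \<le> 3" using defic[of u] by simp
  qed (use sum b J in \<open>auto simp: N_def\<close>)
  then show ?thesis using J by simp
qed

subsection \<open>Matrices with rows of weight at most two\<close>

text \<open>Brings a cycle into alternating form, with \<open>cs ! i\<close> between
  \<open>vs ! i\<close> and its cyclic successor. The edges are given as members of
  \<open>cycle_edges p\<close>, which chordlessness refers to.\<close>

lemma tanner_cycle_columns:
  assumes cyc: "is_cycle (tanner_graph H) p"
  obtains vs cs where "length cs = length vs" "length p = 2 * length vs"
    "distinct vs" "set p = VNode ` set vs \<union> CNode ` set cs"
    "\<And>i. i < length vs \<Longrightarrow> {VNode (vs ! i), CNode (cs ! i)} \<in> cycle_edges p"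
    "\<And>i. i < length vs \<Longrightarrow> {VNode (vs ! (Suc i mod length vs)), CNode (cs ! i)} \<in> cycle_edges p"
proof -
  define n where "n = length p"
  \<comment> \<open>The cycle continued periodically to all indices.\<close>
  define P where "P k = p ! (k mod n)" for k
  define isV where "isV x \<longleftrightarrow> (\<exists>j. x = VNode j)" for x
  have n: "3 \<le> n" "distinct p" using cyc by (auto simp: is_cycle_def n_def)
  have edge_p: "{P k, P (Suc k)} \<in> cycle_edges p" for k
  proof -
    have "P (Suc k) = p ! (Suc (k mod n) mod n)" by (simp add: P_def mod_Suc_eq)
    moreover have "k mod n < n" using n by simp
    ultimately show ?thesis unfolding cycle_edges_def P_def n_def by auto
  qed
  then have edge: "{P k, P (Suc k)} \<in> gedges (tanner_graph H)" for k
    using cyc by (auto simp: is_cycle_def)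
  have alt: "isV (P (Suc k)) \<longleftrightarrow> \<not> isV (P k)" for k
    using edge[of k] by (cases "P k"; cases "P (Suc k)") (auto simp: isV_def)
  have parity: "isV (P (a + k)) \<longleftrightarrow> (even k \<longleftrightarrow> isV (P a))" for a k
    by (induction k) (auto simp: alt)
  \<comment> \<open>The two kinds of nodes alternate, and \<open>n\<close> steps lead back to the
    starting node.\<close>
  have "even n" using parity[of 0 n] by (auto simp: P_def)
  then obtain m where m: "n = 2 * m" by (elim evenE)
  \<comment> \<open>The list may start with a node of either kind; \<open>s\<close> is the position of its first v-node.\<close>
  obtain s where s: "isV (P s)" "s \<le> 1"
    using alt[of 0] by (metis One_nat_def le_refl zero_le)
  define vs where "vs = map (\<lambda>i. THE j. P (s + 2 * i) = VNode j) [0..<m]"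
  define cs where "cs = map (\<lambda>i. THE j. P (s + 2 * i + 1) = CNode j) [0..<m]"
  have vs: "VNode (vs ! i) = P (s + 2 * i)" if "i < m" for i
    using parity[of s "2 * i"] s that by (auto simp: vs_def isV_def)
  have cs: "CNode (cs ! i) = P (s + 2 * i + 1)" if "i < m" for i
    using parity[of s "2 * i + 1"] s that
    by (cases "P (s + 2 * i + 1)") (auto simp: cs_def isV_def)
  have Pmod: "P (s + k mod n) = P (s + k)" for k
    by (simp add: P_def mod_add_right_eq)
  have len: "length vs = m" "length cs = m" by (simp_all add: vs_def cs_def)
  have set_p: "set p = VNode ` set vs \<union> CNode ` set cs"
  proof (intro equalityI subsetI)
    fix x assume "x \<in> set p"
    then obtain k where k: "k < n" "x = p ! k" by (auto simp: in_set_conv_nth n_def)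
    \<comment> \<open>The position counted from \<open>s\<close>. Adding \<open>n\<close> keeps the
      natural subtraction exact.\<close>
    define t where "t = (k + n - s) mod n"
    have "x = P (s + (k + n - s))" using k s n by (simp add: P_def)
    then have x: "x = P (s + t)" by (simp add: t_def Pmod)
    have t: "t < n" using n by (simp add: t_def)
    show "x \<in> VNode ` set vs \<union> CNode ` set cs"
    proof (cases "even t")
      case True
      then obtain i where "t = 2 * i" by (elim evenE)
      then have "i < m" "x = VNode (vs ! i)" using t m x vs by auto
      then show ?thesis using len by auto
    next
      case False
      then obtain i where "t = 2 * i + 1" by (elim oddE)
      then have "i < m" "x = CNode (cs ! i)" using t m x cs by auto
      then show ?thesis using len by auto
    qed
  next
    have "P k \<in> set p" for k using n by (auto simp: P_def n_def intro!: nth_mem mod_less_divisor)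
    then show "x \<in> set p" if "x \<in> VNode ` set vs \<union> CNode ` set cs" for x
      using that by (auto simp: in_set_conv_nth len vs cs)
  qed
  \<comment> \<open>The \<open>2 * m\<close> distinct nodes include at most \<open>m\<close> rows,
    so the \<open>m\<close> entries of \<open>vs\<close> must all differ.\<close>
  have "n = card (set p)" using n by (simp add: n_def distinct_card)
  also have "\<dots> \<le> card (VNode ` set vs) + card (CNode ` set cs)"
    unfolding set_p by (rule card_Un_le)
  also have "\<dots> \<le> card (set vs) + m"
    using card_image_le[of "set vs" VNode] card_image_le[of "set cs" CNode] card_length[of cs] len
    by simp
  finally have "distinct vs"
    using card_length[of vs] len m by (intro card_distinct) simp
  moreover have "{VNode (vs ! i), CNode (cs ! i)} \<in> cycle_edges p" if "i < m" for i
    using edge_p[of "s + 2 * i"] vs[OF that] cs[OF that] by simp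
  moreover have "{VNode (vs ! (Suc i mod m)), CNode (cs ! i)} \<in> cycle_edges p" if "i < m" for i
  proof -
    have "VNode (vs ! (Suc i mod m)) = P (s + 2 * (Suc i mod m))" using that by (intro vs) simp
    also have "2 * (Suc i mod m) = (2 * Suc i) mod n" by (simp add: m mult_mod_right)
    also have "P (s + (2 * Suc i) mod n) = P (s + 2 * i + 2)" by (simp add: Pmod)
    finally show ?thesis
      using edge_p[of "s + 2 * i + 1"] cs[OF that] by (simp add: insert_commute)
  qed
  ultimately show ?thesis
    using that[of cs vs] len set_p m by (simp add: n_def)
qed

text \<open>With rows of weight at most two, Tanner cycles come from cycles of half the length in
  the column graph. A chord of such a cycle with at most six columns joins columns at distance two,
  which gives a triangle, or opposite columns of a hexagon, which \<open>domino\<close> forbids. The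
  4-cycle makes the girth exactly 8.\<close>

lemma in_code_classI:
  assumes weight: "column_weight H 3"
    and row2: "\<And>i a b c. incident H i a \<Longrightarrow> incident H i b \<Longrightarrow> incident H i c \<Longrightarrow>
      a = b \<or> a = c \<or> b = c"
    and uniq: "\<And>i l a b. a \<noteq> b \<Longrightarrow> incident H i a \<Longrightarrow> incident H i b \<Longrightarrow>
      incident H l a \<Longrightarrow> incident H l b \<Longrightarrow> i = l"
    and tri: "\<And>a b c. col_adj H a b \<Longrightarrow> col_adj H b c \<Longrightarrow> \<not> col_adj H a c"
    and domino: "\<And>a b c d e f. distinct [a, b, c, d, e, f] \<Longrightarrow> col_adj H a b \<Longrightarrow>
      col_adj H b c \<Longrightarrow> col_adj H c d \<Longrightarrow> col_adj H d e \<Longrightarrow> col_adj H e f \<Longrightarrow>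
      col_adj H f a \<Longrightarrow> \<not> col_adj H a d"
    and square: "distinct [w, x, y, z]" "col_adj H w x" "col_adj H x y" "col_adj H y z"
      "col_adj H z w"
  shows "in_code_class H (mat_kernel H)"
proof -
  have len: "8 \<le> length p" if cyc: "is_cycle (tanner_graph H) p" for p
  proof (rule ccontr)
    assume "\<not> 8 \<le> length p"
    obtain vs cs where vc: "length cs = length vs" "length p = 2 * length vs" "distinct vs"
      and e1: "\<And>i. i < length vs \<Longrightarrow> {VNode (vs ! i), CNode (cs ! i)} \<in> cycle_edges p"
      and e2: "\<And>i. i < length vs \<Longrightarrow>
        {VNode (vs ! (Suc i mod length vs)), CNode (cs ! i)} \<in> cycle_edges p"
      and set_p: "set p = VNode ` set vs \<union> CNode ` set cs"
      using tanner_cycle_columns[OF cyc] by metis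
    have inc: "incident H (cs ! i) (vs ! i)" "incident H (cs ! i) (vs ! (Suc i mod length vs))"
      if "i < length vs" for i
      using e1[OF that] e2[OF that] cyc unfolding is_cycle_def by (metis subsetD tanner_edge_simps(1))+
    have p: "distinct p" "3 \<le> length p" using cyc by (auto simp: is_cycle_def)
    then consider "length vs = 2" | "length vs = 3"
      using vc \<open>\<not> 8 \<le> length p\<close> by linarith
    then show False
    proof cases
      case 1
      \<comment> \<open>Both rows join the same two columns, so they coincide and \<open>p\<close>
        would have at most three nodes.\<close>
      then have "cs ! 0 = cs ! 1"
        using inc[of 0] inc[of 1] uniq[of "vs ! 0" "vs ! 1"] vc by (simp add: nth_eq_iff_index_eq)
      then have "card (set cs) \<le> 1"
        using 1 vc(1) by (auto simp: length_Suc_conv numeral_2_eq_2)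
      moreover have "card (set p) \<le> card (set vs) + card (set cs)"
        unfolding set_p by (rule order_trans[OF card_Un_le]) (intro add_mono card_image_le; simp)
      ultimately show False
        using p card_length[of vs] 1 vc by (simp add: distinct_card)
    next
      case 2
      then have "col_adj H (vs ! i) (vs ! (Suc i mod 3))" if "i < 3" for i
        unfolding col_adj_def using inc[of i] vc that by (auto simp: nth_eq_iff_index_eq mod_Suc)
      from this[of 0] this[of 1] this[of 2]
      have "col_adj H (vs ! 0) (vs ! 1)" "col_adj H (vs ! 1) (vs ! 2)" "col_adj H (vs ! 2) (vs ! 0)"
        by (simp_all add: numeral_2_eq_2)
      then show False using tri col_adj_sym by blast
    qed
  qed
  have chordless: "chordless H p" if cyc: "is_cycle (tanner_graph H) p" and le: "length p \<le> 12" for p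
  proof -
    obtain vs cs where vc: "length cs = length vs" "length p = 2 * length vs" "distinct vs"
      and e1: "\<And>i. i < length vs \<Longrightarrow> {VNode (vs ! i), CNode (cs ! i)} \<in> cycle_edges p"
      and e2: "\<And>i. i < length vs \<Longrightarrow>
        {VNode (vs ! (Suc i mod length vs)), CNode (cs ! i)} \<in> cycle_edges p"
      and set_p: "set p = VNode ` set vs \<union> CNode ` set cs"
      using tanner_cycle_columns[OF cyc] by metis
    have inc: "incident H (cs ! i) (vs ! i)" "incident H (cs ! i) (vs ! (Suc i mod length vs))"
      if "i < length vs" for i
      using e1[OF that] e2[OF that] cyc unfolding is_cycle_def by (metis subsetD tanner_edge_simps(1))+
    have k: "4 \<le> length vs" "length vs \<le> 6" using len[OF cyc] le vc by auto
    have ne: "vs ! i \<noteq> vs ! (Suc i mod length vs)" if "i < length vs" for i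
    proof -
      have "i \<noteq> Suc i mod length vs" using that k by (auto simp: mod_Suc)
      moreover have "Suc i mod length vs < length vs" using that by (intro mod_less_divisor) linarith
      ultimately show ?thesis using that vc(3) nth_eq_iff_index_eq by blast
    qed
    \<comment> \<open>A row on the cycle already has its two columns there, so all its edges belong
      to the cycle.\<close>
    have "{VNode a, CNode r} \<in> cycle_edges p"
      if ra: "incident H r a" and rc: "r \<in> set cs" for a r
    proof -
      obtain i where i: "i < length vs" "r = cs ! i" using rc vc(1) by (auto simp: in_set_conv_nth)
      then have "a = vs ! i \<or> a = vs ! (Suc i mod length vs)"
        using row2 inc[OF i(1)] ne[OF i(1)] ra by blast
      then show ?thesis using e1 e2 i by auto
    qed
    then have no2: "\<not> (\<exists>v \<in> set p \<inter> vnodes H. \<exists>c \<in> set p \<inter> cnodes H.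
          {v, c} \<in> gedges (tanner_graph H) - cycle_edges p)"
      unfolding set_p by (auto simp: vnodes_def cnodes_def)
    have no1: False
      if r: "r \<notin> set cs" and ab: "a \<in> set vs" "b \<in> set vs" "a \<noteq> b"
        and ra: "incident H r a" "incident H r b" for r a b
    proof -
      \<comment> \<open>\<open>X x y\<close> means that \<open>x\<close>, \<open>y\<close> are the
        ends of the supposed chord. It is refuted for each pair of positions: neighbouring ones by
        \<open>cons\<close>, those at distance two by \<open>dist2\<close>, opposite ones in a
        hexagon by \<open>domino\<close>.\<close>
      define X where "X x y \<longleftrightarrow> x \<in> {a, b} \<and> y \<in> {a, b} \<and> x \<noteq> y" for x y
      have Xsym: "X y x" if "X x y" for x y using that by (auto simp: X_def)
      have Xadj: "col_adj H x y" if "X x y" for x y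
        using that ra by (auto simp: X_def col_adj_def)
      have adj: "col_adj H (vs ! i) (vs ! (Suc i mod length vs))" if "i < length vs" for i
        unfolding col_adj_def using ne inc that by blast
      have cons: "\<not> X (vs ! i) (vs ! (Suc i mod length vs))" if "i < length vs" for i
      proof
        assume "X (vs ! i) (vs ! (Suc i mod length vs))"
        then have "r = cs ! i" using uniq[OF ne[OF that]] inc[OF that] ra by (auto simp: X_def)
        then show False using r that vc(1) by auto
      qed
      have dist2: "\<not> X x z" if "col_adj H x y" "col_adj H y z" for x y z
        using tri[OF that] Xadj by blast
      have ex: "X a b" using ab by (auto simp: X_def)
      consider "length vs = 4" | "length vs = 5" | "length vs = 6" using k by linarith
      then show False
      proof cases
        case 1
        then obtain v0 v1 v2 v3 where vs: "vs = [v0, v1, v2, v3]"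
          by (auto simp: numeral_eq_Suc length_Suc_conv)
        have A: "col_adj H v0 v1" "col_adj H v1 v2" "col_adj H v2 v3" "col_adj H v3 v0"
          using adj[of 0] adj[of 1] adj[of 2] adj[of 3] by (simp_all add: vs)
        have C: "\<not> X v0 v1" "\<not> X v1 v2" "\<not> X v2 v3" "\<not> X v3 v0"
          using cons[of 0] cons[of 1] cons[of 2] cons[of 3] by (simp_all add: vs)
        show False
          using ab ex C Xsym dist2[OF A(1,2)] dist2[OF A(2,3)] unfolding vs by auto
      next
        case 2
        then obtain v0 v1 v2 v3 v4 where vs: "vs = [v0, v1, v2, v3, v4]"
          by (auto simp: numeral_eq_Suc length_Suc_conv)
        have A: "col_adj H v0 v1" "col_adj H v1 v2" "col_adj H v2 v3" "col_adj H v3 v4"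
            "col_adj H v4 v0"
          using adj[of 0] adj[of 1] adj[of 2] adj[of 3] adj[of 4] by (simp_all add: vs)
        have C: "\<not> X v0 v1" "\<not> X v1 v2" "\<not> X v2 v3" "\<not> X v3 v4" "\<not> X v4 v0"
          using cons[of 0] cons[of 1] cons[of 2] cons[of 3] cons[of 4] by (simp_all add: vs)
        show False
          using ab ex C Xsym dist2[OF A(1,2)] dist2[OF A(2,3)] dist2[OF A(3,4)] dist2[OF A(4,5)]
            dist2[OF A(5,1)] unfolding vs by auto
      next
        case 3
        then obtain v0 v1 v2 v3 v4 v5 where vs: "vs = [v0, v1, v2, v3, v4, v5]"
          by (auto simp: numeral_eq_Suc length_Suc_conv)
        have A: "col_adj H v0 v1" "col_adj H v1 v2" "col_adj H v2 v3" "col_adj H v3 v4"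
            "col_adj H v4 v5" "col_adj H v5 v0"
          using adj[of 0] adj[of 1] adj[of 2] adj[of 3] adj[of 4] adj[of 5] by (simp_all add: vs)
        have C: "\<not> X v0 v1" "\<not> X v1 v2" "\<not> X v2 v3" "\<not> X v3 v4" "\<not> X v4 v5" "\<not> X v5 v0"
          using cons[of 0] cons[of 1] cons[of 2] cons[of 3] cons[of 4] cons[of 5]
          by (simp_all add: vs)
        have "\<not> X v0 v3" "\<not> X v1 v4" "\<not> X v2 v5"
          using domino[of v0 v1 v2 v3 v4 v5] domino[of v1 v2 v3 v4 v5 v0]
            domino[of v2 v3 v4 v5 v0 v1] A vc(3) Xadj unfolding vs by auto
        then show False
          using ab ex C Xsym dist2[OF A(1,2)] dist2[OF A(2,3)] dist2[OF A(3,4)] dist2[OF A(4,5)]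
            dist2[OF A(5,6)] dist2[OF A(6,1)] unfolding vs by auto
      qed
    qed
    show ?thesis
      unfolding chordless_def
    proof (intro conjI no2 notI)
      assume "\<exists>c\<in>cnodes H - set p. \<exists>v\<in>set p \<inter> vnodes H. \<exists>w\<in>set p \<inter> vnodes H.
        v \<noteq> w \<and> adjacent (tanner_graph H) c v \<and> adjacent (tanner_graph H) c w"
      then obtain r a b where "CNode r \<notin> set p" "VNode a \<in> set p" "VNode b \<in> set p" "a \<noteq> b"
          "incident H r a" "incident H r b"
        by (auto simp: cnodes_def vnodes_def adjacent_def) blast
      then show False using no1[of r a b] by (auto simp: set_p)
    qed
  qed
  \<comment> \<open>The 4-cycle of columns lifts to a Tanner cycle of length 8.\<close>
  obtain i1 i2 i3 i4 where i: "incident H i1 w" "incident H i1 x" "incident H i2 x" "incident H i2 y"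
      "incident H i3 y" "incident H i3 z" "incident H i4 z" "incident H i4 w"
    using square by (auto simp: col_adj_def)
  have "distinct [i1, i2, i3, i4]"
    using i row2[of i1 w x] row2[of i2 x y] row2[of i3 y z] row2[of i4 z w] square(1) by auto
  then have "is_cycle (tanner_graph H)
      [VNode w, CNode i1, VNode x, CNode i2, VNode y, CNode i3, VNode z, CNode i4]" (is "is_cycle _ ?p")
    using i square(1) by (simp add: is_cycle_tanner_successively)
  then have "girth (tanner_graph H) \<le> enat (length ?p)"
    unfolding girth_def by (intro INF_lower) simp
  also have "length ?p = 8" by simp
  finally have "girth (tanner_graph H) \<le> 8" by (simp add: numeral_eq_enat)
  moreover have "8 \<le> girth (tanner_graph H)"
    unfolding girth_def using len by (intro INF_greatest) (auto simp: numeral_eq_enat)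
  ultimately have "girth (tanner_graph H) = 8" by (rule antisym)
  then show ?thesis
    using weight chordless by (simp add: in_code_class_def parity_check_matrix_def)
qed

section \<open>Matrices given by lists of rows\<close>

definition row_matrix :: "nat \<Rightarrow> nat list list \<Rightarrow> bit mat" where
  "row_matrix n rs = mat (length rs) n (\<lambda>(i, j). if j \<in> set (rs ! i) then 1 else 0)"

lemma incident_row_matrix:
  "incident (row_matrix n rs) i j \<longleftrightarrow> i < length rs \<and> j < n \<and> j \<in> set (rs ! i)"
  by (auto simp: incident_def row_matrix_def split: if_splits)

definition row_nbrs :: "nat list list \<Rightarrow> nat \<Rightarrow> nat list" where
  "row_nbrs rs j = removeAll j (concat (filter (\<lambda>r. j \<in> set r) rs))"

text \<open>The last three conditions concern the graph joining two columns that share a row: no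
  triangles, no 6-cycle \<open>a b c d e f\<close> with the chord \<open>a d\<close>, and some 4-cycle \<open>w x y z\<close>.\<close>

definition good_rows :: "nat \<Rightarrow> nat list list \<Rightarrow> bool" where
  "good_rows n rs \<longleftrightarrow>
     (\<forall>r\<in>set rs. length r \<le> 2 \<and> sorted_wrt (<) r \<and> (\<forall>j\<in>set r. j < n)) \<and> distinct rs \<and>
     (\<forall>j\<in>set [0..<n]. length (filter (\<lambda>r. j \<in> set r) rs) = 3) \<and>
     (let nb = map (row_nbrs rs) [0..<n] in
       (\<forall>a\<in>set [0..<n]. \<forall>b\<in>set (nb ! a). \<forall>c\<in>set (nb ! b). c \<notin> set (nb ! a)) \<and>
       (\<forall>a\<in>set [0..<n]. \<forall>d\<in>set (nb ! a). \<forall>b\<in>set (nb ! a). b \<noteq> d \<longrightarrow>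
         (\<forall>c\<in>set (nb ! b). c \<noteq> a \<and> c \<in> set (nb ! d) \<longrightarrow>
         (\<forall>e\<in>set (nb ! d). e \<noteq> a \<and> e \<noteq> c \<longrightarrow>
         (\<forall>f\<in>set (nb ! e). f \<noteq> b \<and> f \<noteq> d \<longrightarrow> f \<notin> set (nb ! a))))) \<and>
       (\<exists>w\<in>set [0..<n]. \<exists>y\<in>set [0..<w]. \<exists>x\<in>set (nb ! w). \<exists>z\<in>set (nb ! w).
          x \<noteq> z \<and> x \<in> set (nb ! y) \<and> z \<in> set (nb ! y)))"

lemma two_equal_if_length_le_2:
  assumes "length r \<le> 2" "a \<in> set r" "b \<in> set r" "c \<in> set r"
  shows "a = b \<or> a = c \<or> b = c"
  using assms by (auto simp: le_Suc_eq numeral_2_eq_2 length_Suc_conv)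

text \<open>Lets \<open>distinct rs\<close> ensure that two columns share at most one row: sorted
  rows containing the same two columns are equal as lists.\<close>

lemma sorted_pair_eqI:
  fixes a b :: nat
  assumes "length r \<le> 2" "sorted_wrt (<) r" "a \<in> set r" "b \<in> set r" "a < b"
  shows "r = [a, b]"
  using assms by (auto simp: le_Suc_eq numeral_2_eq_2 length_Suc_conv)

lemma good_rows_in_code_class:
  assumes good: "good_rows n rs"
  shows "in_code_class (row_matrix n rs) (mat_kernel (row_matrix n rs))" (is "in_code_class ?H _")
proof -
  define nb where "nb = map (row_nbrs rs) [0..<n]"
  note g = good[unfolded good_rows_def Let_def, folded nb_def]
  note rows = g[THEN conjunct1] and distinct_rows = g[THEN conjunct2, THEN conjunct1]
    and weights = g[THEN conjunct2, THEN conjunct2, THEN conjunct1]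
  note graph = g[THEN conjunct2, THEN conjunct2, THEN conjunct2]
  note triangles = graph[THEN conjunct1]
    and hexagons = graph[THEN conjunct2, THEN conjunct1]
    and squares = graph[THEN conjunct2, THEN conjunct2]
  have row: "rs ! i \<in> set rs" "length (rs ! i) \<le> 2" "sorted_wrt (<) (rs ! i)"
    "\<And>j. j \<in> set (rs ! i) \<Longrightarrow> j < n" if "i < length rs" for i
    using rows nth_mem[OF that] by auto
  have adj: "col_adj ?H j k \<longleftrightarrow> j < n \<and> k \<in> set (nb ! j)" for j k
  proof -
    have "(\<exists>i<length rs. j \<in> set (rs ! i) \<and> k \<in> set (rs ! i)) \<longleftrightarrow>
        (\<exists>r\<in>set rs. j \<in> set r \<and> k \<in> set r)"
      by (auto simp: set_conv_nth)
    then show ?thesis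
      using row(4) by (auto simp: col_adj_def incident_row_matrix nb_def row_nbrs_def)
  qed
  have distinct: "i = l" if "i < length rs" "l < length rs" "rs ! i = rs ! l" for i l
    using that distinct_rows by (simp add: nth_eq_iff_index_eq)
  have uniq: "i = l"
    if "a \<noteq> b" "incident ?H i a" "incident ?H i b" "incident ?H l a" "incident ?H l b" for i l a b
  proof (rule distinct)
    show il: "i < length rs" "l < length rs" using that by (auto simp: incident_row_matrix)
    show "rs ! i = rs ! l"
      using row(2,3)[OF il(1)] row(2,3)[OF il(2)] that
        sorted_pair_eqI[of "rs ! i" a b] sorted_pair_eqI[of "rs ! l" a b]
        sorted_pair_eqI[of "rs ! i" b a] sorted_pair_eqI[of "rs ! l" b a]
      by (cases "a < b") (auto simp: incident_row_matrix)
  qed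
  have weight: "column_weight ?H 3"
    unfolding column_weight_iff
  proof (intro allI impI)
    fix j assume "j < dim_col ?H"
    then have j: "j < n" by (simp add: row_matrix_def)
    then have "card {i. incident ?H i j} = length (filter (\<lambda>r. j \<in> set r) rs)"
      by (simp add: length_filter_conv_card incident_row_matrix)
    then show "card {i. incident ?H i j} = 3" using weights j by simp
  qed
  obtain w x y z where "w < n" "y < w" "x \<in> set (nb ! w)" "z \<in> set (nb ! w)" "x \<noteq> z"
      "x \<in> set (nb ! y)" "z \<in> set (nb ! y)"
    using squares by auto
  then have A: "col_adj ?H w x" "col_adj ?H w z" "col_adj ?H y x" "col_adj ?H y z" "w \<noteq> y" "x \<noteq> z"
    by (auto simp: adj)
  show ?thesis
  proof (rule in_code_classI[OF weight])
    show "i = l"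
      if "a \<noteq> b" "incident ?H i a" "incident ?H i b" "incident ?H l a" "incident ?H l b" for i l a b
      using that by (rule uniq)
    show "a = b \<or> a = c \<or> b = c"
      if "incident ?H i a" "incident ?H i b" "incident ?H i c" for i a b c
      using that row(2)[of i] two_equal_if_length_le_2[of "rs ! i" a b c]
      by (auto simp: incident_row_matrix)
    show "\<not> col_adj ?H a c" if "col_adj ?H a b" "col_adj ?H b c" for a b c
      using that triangles by (auto simp: adj)
    show "\<not> col_adj ?H a d"
      if "distinct [a, b, c, d, e, f]" "col_adj ?H a b" "col_adj ?H b c" "col_adj ?H c d"
        "col_adj ?H d e" "col_adj ?H e f" "col_adj ?H f a" for a b c d e f
    proof
      assume ad: "col_adj ?H a d"
      have "c \<in> set (nb ! d)" "f \<in> set (nb ! a)"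
        using that(4,7)[THEN col_adj_sym] by (auto simp: adj)
      moreover have "a < n" "d \<in> set (nb ! a)" "b \<in> set (nb ! a)" "c \<in> set (nb ! b)"
        "e \<in> set (nb ! d)" "f \<in> set (nb ! e)"
        using ad that by (auto simp: adj)
      ultimately show False using hexagons[rule_format, of a d b c e f] that(1) by auto
    qed
    show "distinct [w, x, y, z]" using A by (auto simp: col_adj_def)
  qed (use A A(2,3)[THEN col_adj_sym] in simp_all)
qed

text \<open>The trapping set consists of all columns, so the degree of a row in it is its
  length.\<close>

lemma good_rows_ets_size:
  assumes good: "good_rows n rs" and b: "length (filter (\<lambda>r. odd (length r)) rs) = b" "b < n"
  shows "n \<in> ets_sizes b"
proof -
  let ?H = "row_matrix n rs" and ?S = "VNode ` {..<n}"
  have rows: "{j \<in> {..<n}. incident ?H i j} = (if i < length rs then set (rs ! i) else {})" for i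
    using good by (auto simp: incident_row_matrix good_rows_def)
  have card_row: "card (set (rs ! i)) = length (rs ! i)" "length (rs ! i) \<le> 2" if "i < length rs" for i
    using good that by (auto simp: good_rows_def strict_sorted_iff distinct_card)
  have "{i. odd (card {j \<in> {..<n}. incident ?H i j})} = {i. i < length rs \<and> odd (length (rs ! i))}"
    unfolding rows using card_row by (auto split: if_splits)
  then have "trapping_set ?H n b ?S"
    using b by (auto simp: trapping_set_VNode_iff row_matrix_def length_filter_conv_card)
  moreover have "elementary ?H ?S"
  proof (subst elementary_VNode_iff)
    show "{..<n} \<subseteq> {..<dim_col ?H}" by (simp add: row_matrix_def)
    show "\<forall>i. card {j \<in> {..<n}. incident ?H i j} \<le> 2" unfolding rows using card_row by simp
  qed
  ultimately show ?thesis
    using good_rows_in_code_class[OF good] b(2) by (auto simp: ets_sizes_def)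
qed

section \<open>The minimum sizes\<close>

lemma ets_sizes_lower:
  assumes "a \<in> ets_sizes b" "b \<le> 2"
  shows "10 - b \<le> a"
proof -
  obtain H C S where H: "b < a" "in_code_class H C" "trapping_set H a b S" "elementary H S"
    using assms(1) by (auto simp: ets_sizes_def)
  have "9 \<le> a + b" using ets_size_ge[OF H(2-4) assms(2) H(1)] .
  moreover have "even (a + b)" using trapping_set_parity H by (auto simp: in_code_class_def)
  then have "a + b \<noteq> 9" by (metis odd_numeral)
  ultimately show ?thesis by linarith
qed

lemma ets_sizes_3_lower:
  assumes "a \<in> ets_sizes 3"
  shows "5 \<le> a"
proof -
  obtain H C S where H: "3 < a" "in_code_class H C" "trapping_set H a 3 S"
    using assms by (auto simp: ets_sizes_def)
  then have "even (a + 3)" using trapping_set_parity by (auto simp: in_code_class_def)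
  then have "a \<noteq> 4" by auto
  then show ?thesis using H(1) by linarith
qed

theorem lemma1:
  shows "is_minimum (ets_sizes 0) 10 \<and> is_minimum (ets_sizes 1) 9 \<and>
         is_minimum (ets_sizes 2) 8 \<and> is_minimum (ets_sizes 3) 5"
proof -
  \<comment> \<open>Two copies of \<open>K(2,3)\<close>, with parts 1, 2 against 0, 4, 5 and 6, 7
    against 3, 8, 9, joined by the edges 0-3, 4-8, 5-9. Distinct 4-cycles in \<open>K(2,3)\<close>
    share two edges, never exactly one.\<close>
  have "good_rows 10 [[0,1], [0,2], [0,3], [1,4], [1,5], [2,4], [2,5], [3,6], [3,7], [4,8], [5,9],
      [6,8], [6,9], [7,8], [7,9]]"
    by code_simp
  then have "10 \<in> ets_sizes 0" by (rule good_rows_ets_size) simp_all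
  \<comment> \<open>The first \<open>K(2,3)\<close> again, joined by the edges 0-3, 4-6, 5-7 to the
    4-cycle 3, 6, 8, 7. Only node 8 lacks an edge.\<close>
  moreover have "good_rows 9 [[0,1], [0,2], [0,3], [1,4], [1,5], [2,4], [2,5], [3,6], [3,7], [4,6],
      [5,7], [6,8], [7,8], [8]]"
    by code_simp
  then have "9 \<in> ets_sizes 1" by (rule good_rows_ets_size) simp_all
  \<comment> \<open>The previous graph without node 8, so that 6 and 7 lack an edge each.\<close>
  moreover have "good_rows 8 [[0,1], [0,2], [0,3], [1,4], [1,5], [2,4], [2,5], [3,6], [3,7], [4,6],
      [5,7], [6], [7]]"
    by code_simp
  then have "8 \<in> ets_sizes 2" by (rule good_rows_ets_size) simp_all
  moreover have "good_rows 5 [[0,2], [0,3], [0,4], [1,2], [1,3], [1,4], [2], [3], [4]]"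
    by code_simp
  then have "5 \<in> ets_sizes 3" by (rule good_rows_ets_size) simp_all
  moreover have "10 \<le> a" if "a \<in> ets_sizes 0" for a using ets_sizes_lower[OF that] by simp
  moreover have "9 \<le> a" if "a \<in> ets_sizes 1" for a using ets_sizes_lower[OF that] by simp
  moreover have "8 \<le> a" if "a \<in> ets_sizes 2" for a using ets_sizes_lower[OF that] by simp
  ultimately show ?thesis
    unfolding is_minimum_def using ets_sizes_3_lower by blast
qed

end
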